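(* Let $a\in\mathbb{C}$ with $a\neq q^{-m}$ for $m=0,1,2,\ldots$. Then \begin{align*} \frac{(-a, q; q)_\infty} {(a, -q; q)_\infty}\sum_{n=0}^\infty \frac{q^{n(n-1)/2}}{(-a; q)_n} =\sum_{n=0}^\infty \sum_{j=-n}^n (-1)^{n+j} q^{(3n^2-n)/2-j^2} \frac{(q/a; q)_n a^n}{(a; q)_n}\biggl(1+q^n+\bigl(1+q^{n+1}\bigr)\frac{q^{2n}\bigl(a-q^{n+1}\bigr)}{1-aq^n}\biggr), \end{align*} or equivalently \begin{align*} \frac{(-a, q; q)_\infty} {(a, -q; q)_\infty}\sum_{n=0}^\infty \frac{q^{n(n-1)/2}}{(-a; q)_n} ={}&2+2\sum_{n=1}^\infty (1+q^n) \frac{(q/a; q)_n a^n}{(a; q)_n} q^{n(n-1)/2}\\ &-\sum_{n=1}^\infty \bigl(1-q^{2n}\bigr)\frac{(q/a; q)_n (-a)^n}{(a; q)_n} \sum_{|j|<n} (-1)^j q^{3n(n-1)/2-j^2}. \end{align*}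
   Context: Throughout, $q$ is a complex number with $0<|q|<1$. For $x\in\mathbb{C}$, $(x;q)_\infty=\prod_{k=0}^\infty(1-xq^k)$ and, for an integer $n\ge 0$, $(x;q)_n=\prod_{k=0}^{n-1}(1-xq^k)$; also $(x_1,\dots,x_m;q)_n=(x_1;q)_n\cdots(x_m;q)_n$ for $n$ an integer or $\infty$. The inner sum $\sum_{|j|<n}$ runs over integers $j$ with $-n<j<n$. *)

theory Defs
  imports "HOL-Analysis.Analysis"
begin

definition qpoch :: "complex \<Rightarrow> complex \<Rightarrow> nat \<Rightarrow> complex" where
  "qpoch x q n = (\<Prod>k<n. 1 - x * q ^ k)"

definition qpoch_inf :: "complex \<Rightarrow> complex \<Rightarrow> complex" where
  "qpoch_inf x q = (\<Prod>k. 1 - x * q ^ k)"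

end

theory Submission
  imports Defs
begin

text \<open>
  Write $E_n(x) = \prod_{k=1}^{n} (x - q^k) \cdot (xq^n; q)_\infty$, so that
  $(q/a; q)_n a^n / (a; q)_n = E_n(a) / (a; q)_\infty$. Multiplied by $(a; q)_\infty$, the second
  right-hand side is a series $R(a) = \sum_n c_n E_n(a)$, and the left-hand side is $C F(a)$ with
  $C = (q; q)_\infty / (-q; q)_\infty$ and $F(a) = \sum_n q^{n(n-1)/2} (-aq^n; q)_\infty$.
  Shifting the summation index gives $F(aq) = (1 - a) F(a) + a (-a; q)_\infty$, and telescoping sums
  show that $R(aq) = (1 - a) R(a) + a H(a)$, where $H$ is the series with the theta coefficients
  $1, 2, 2q, 2q^3, \dots$; a further telescoping sum gives $H(a) = (1 + a) H(aq)$, hence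
  $H(a) = C (-a; q)_\infty$. So $\Delta = R - C F$ satisfies $\Delta(aq) = (1 - a) \Delta(a)$.
  Putting $a = 1$ yields $\Delta(q) = 0$, and iterating towards the origin, where $\Delta$ is
  continuous, yields first $\Delta(0) = 0$ and then $(a; q)_\infty \Delta(a) = 0$ for all $a$.
  The two right-hand sides differ by a telescoping series.
\<close>

section \<open>q-shifted factorials: limits, splitting and bounds\<close>

lemma qpoch_0 [simp]: "qpoch x q 0 = 1"
  by (simp add: qpoch_def)

lemma qpoch_Suc: "qpoch x q (Suc n) = qpoch x q n * (1 - x * q ^ n)"
  by (simp add: qpoch_def)

lemma qpoch_Suc_shift: "qpoch x q (Suc n) = (1 - x) * qpoch (x * q) q n"
  unfolding qpoch_def by (subst prod.lessThan_Suc_shift) (simp add: mult.assoc)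

lemma convergent_prod_qpoch:
  fixes q x :: complex
  assumes "norm q < 1"
  shows "convergent_prod (\<lambda>k. 1 - x * q ^ k)"
proof (intro abs_convergent_prod_imp_convergent_prod summable_imp_abs_convergent_prod)
  show "summable (\<lambda>k. norm (1 - x * q ^ k - 1))"
    using assms by (auto simp: norm_mult norm_power intro!: summable_mult summable_geometric)
qed

lemma qpoch_LIMSEQ:
  assumes "norm q < 1"
  shows "qpoch x q \<longlonglongrightarrow> qpoch_inf x q"
proof -
  have "(\<lambda>n. qpoch x q (Suc n)) \<longlonglongrightarrow> qpoch_inf x q"
    using convergent_prod_LIMSEQ[OF convergent_prod_qpoch[OF assms]]
    by (simp add: qpoch_def qpoch_inf_def lessThan_Suc_atMost)
  then show ?thesis
    by (simp only: filterlim_sequentially_Suc)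
qed

lemma qpoch_inf_nonzero:
  assumes "norm q < 1" "\<And>k. x * q ^ k \<noteq> 1"
  shows "qpoch_inf x q \<noteq> 0"
  unfolding qpoch_inf_def using assms
  by (intro prodinf_nonzero convergent_prod_qpoch) (metis right_minus_eq)+

lemma qpoch_inf_unfold:
  assumes "norm q < 1"
  shows "qpoch_inf x q = (1 - x) * qpoch_inf (x * q) q"
proof (rule LIMSEQ_unique)
  show "(\<lambda>n. qpoch x q (Suc n)) \<longlonglongrightarrow> qpoch_inf x q"
    using qpoch_LIMSEQ[OF assms] by (rule LIMSEQ_Suc)
  show "(\<lambda>n. qpoch x q (Suc n)) \<longlonglongrightarrow> (1 - x) * qpoch_inf (x * q) q"
    unfolding qpoch_Suc_shift by (intro tendsto_mult tendsto_const qpoch_LIMSEQ assms)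
qed

lemma qpoch_inf_split:
  assumes "norm q < 1"
  shows "qpoch_inf x q = qpoch x q n * qpoch_inf (x * q ^ n) q"
proof (induction n)
  case (Suc n)
  then show ?case
    using qpoch_inf_unfold[OF assms, of "x * q ^ n"] by (simp add: qpoch_Suc mult_ac)
qed simp

text \<open>Finite products are compared with products of \<open>1 + norm x * norm q ^ k\<close>,
  then with exponentials and a geometric series. The bound passes to the limit; it yields both the
  uniform bound on discs and continuity at the origin.\<close>

lemma norm_qpoch_inf_minus_1_le:
  assumes "norm q < 1"
  shows "norm (qpoch_inf x q - 1) \<le> exp (norm x / (1 - norm q)) - 1"
proof (rule LIMSEQ_le_const2)
  show "(\<lambda>n. norm (qpoch x q n - 1)) \<longlonglongrightarrow> norm (qpoch_inf x q - 1)"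
    by (intro tendsto_intros qpoch_LIMSEQ assms)
  have "norm (qpoch x q n - 1) \<le> exp (norm x / (1 - norm q)) - 1" for n
  proof -
    have "norm (qpoch x q n - 1) \<le> (\<Prod>k<n. 1 + norm x * norm q ^ k) - 1"
      using norm_prod_minus1_le_prod_minus1[of "\<lambda>k. - (x * q ^ k)" "{..<n}"]
      by (simp add: qpoch_def norm_mult norm_power)
    also have "(\<Prod>k<n. 1 + norm x * norm q ^ k) \<le> (\<Prod>k<n. exp (norm x * norm q ^ k))"
      by (intro prod_mono) (auto intro: exp_ge_add_one_self)
    also have "\<dots> = exp (norm x * (\<Sum>k<n. norm q ^ k))"
      by (simp add: exp_sum sum_distrib_left)
    also have "(\<Sum>k<n. norm q ^ k) \<le> 1 / (1 - norm q)"
    proof -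
      have "(\<Sum>k<n. norm q ^ k) \<le> (\<Sum>k. norm q ^ k)"
        using assms by (intro sum_le_suminf summable_geometric) auto
      then show ?thesis
        using assms by (simp add: suminf_geometric)
    qed
    finally show ?thesis
      by (simp add: mult_left_mono)
  qed
  then show "\<exists>N. \<forall>n\<ge>N. norm (qpoch x q n - 1) \<le> exp (norm x / (1 - norm q)) - 1"
    by blast
qed

lemma norm_qpoch_inf_le:
  assumes "norm q < 1" "norm x \<le> r"
  shows "norm (qpoch_inf x q) \<le> exp (r / (1 - norm q))"
proof -
  have "norm (qpoch_inf x q) \<le> norm (qpoch_inf x q - 1) + 1"
    using norm_triangle_ineq[of "qpoch_inf x q - 1" 1] by simp
  also have "\<dots> \<le> exp (norm x / (1 - norm q))"
    using norm_qpoch_inf_minus_1_le[OF assms(1), of x] by simp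
  also have "\<dots> \<le> exp (r / (1 - norm q))"
    using assms by (simp add: divide_right_mono)
  finally show ?thesis .
qed

lemma qpoch_inf_0 [simp]: "qpoch_inf 0 q = 1"
  by (simp add: qpoch_inf_def)

lemma tendsto_qpoch_inf_0:
  assumes "norm q < 1" "(f \<longlongrightarrow> 0) F"
  shows "((\<lambda>x. qpoch_inf (f x) q) \<longlongrightarrow> 1) F"
proof -
  have "((\<lambda>x. exp (norm (f x) / (1 - norm q)) - 1) \<longlongrightarrow> exp (norm (0::complex) / (1 - norm q)) - 1) F"
    using assms by (intro tendsto_intros) auto
  then have lim: "((\<lambda>x. exp (norm (f x) / (1 - norm q)) - 1) \<longlongrightarrow> 0) F"
    by simp
  have "((\<lambda>x. qpoch_inf (f x) q - 1) \<longlongrightarrow> 0) F"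
    by (rule Lim_null_comparison[OF always_eventually lim])
       (use norm_qpoch_inf_minus_1_le[OF assms(1)] in blast)
  then show ?thesis
    using Lim_null by blast
qed

section \<open>Convergence from triangular exponents\<close>

lemma triangular_Suc: "Suc n * n div 2 = n + n * (n - 1) div 2"
  by (cases n) (auto simp: algebra_simps)

text \<open>Consecutive terms have ratio \<open>K * r ^ n\<close>, which tends to 0 however large
  \<open>K\<close> is.\<close>

lemma summable_power_times_triangular_power:
  fixes K r :: real
  assumes "0 \<le> r" "r < 1"
  shows "summable (\<lambda>n::nat. K ^ n * r ^ (n * (n - 1) div 2))"
proof -
  have "(\<lambda>n. \<bar>K\<bar> * r ^ n) \<longlonglongrightarrow> 0"
    using assms by (intro tendsto_mult_right_zero LIMSEQ_realpow_zero) auto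
  then have "\<forall>\<^sub>F n in sequentially. \<bar>K\<bar> * r ^ n < 1 / 2"
    by (rule order_tendstoD) auto
  then obtain N where N: "\<And>n. n \<ge> N \<Longrightarrow> \<bar>K\<bar> * r ^ n < 1 / 2"
    by (auto simp: eventually_sequentially)
  show ?thesis
  proof (rule summable_ratio_test)
    fix n assume "n \<ge> N"
    have "norm (K ^ Suc n * r ^ (Suc n * (Suc n - 1) div 2))
        = (\<bar>K\<bar> * r ^ n) * norm (K ^ n * r ^ (n * (n - 1) div 2))"
      using assms triangular_Suc[of n]
      by (simp add: norm_mult norm_power power_add abs_mult power_abs)
    also have "\<dots> \<le> 1 / 2 * norm (K ^ n * r ^ (n * (n - 1) div 2))"
      using N[OF \<open>n \<ge> N\<close>] by (intro mult_right_mono) auto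
    finally show "norm (K ^ Suc n * r ^ (Suc n * (Suc n - 1) div 2))
        \<le> 1 / 2 * norm (K ^ n * r ^ (n * (n - 1) div 2))" .
  qed simp
qed

text \<open>This is \<open>x^n (q/x; q)_n\<close> with the powers of \<open>x\<close> multiplied
  into the factors, which gives it a meaning at \<open>x = 0\<close>.\<close>

definition basis_poly :: "complex \<Rightarrow> nat \<Rightarrow> complex \<Rightarrow> complex" where
  "basis_poly q n x = (\<Prod>k<n. x - q ^ (k + 1))"

lemma basis_poly_0 [simp]: "basis_poly q 0 x = 1"
  by (simp add: basis_poly_def)

lemma basis_poly_Suc: "basis_poly q (Suc n) x = basis_poly q n x * (x - q ^ Suc n)"
  by (simp add: basis_poly_def)

text \<open>Each factor \<open>x * q - q ^ (k + 1)\<close> is \<open>q * (x - q ^ k)\<close>; the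
  one for \<open>k = 0\<close> gives \<open>x - 1\<close>, and the others form the polynomial of
  degree one less.\<close>

lemma basis_poly_Suc_scale: "basis_poly q (Suc n) (x * q) = q ^ Suc n * (x - 1) * basis_poly q n x"
proof -
  have "basis_poly q m (x * q) = q ^ m * (\<Prod>k<m. x - q ^ k)" for m
    by (induction m) (auto simp: basis_poly_Suc algebra_simps)
  then show ?thesis
    by (simp add: basis_poly_def prod.lessThan_Suc_shift del: prod.lessThan_Suc)
qed

lemma norm_basis_poly_le:
  assumes "norm q < 1" "norm x \<le> r"
  shows "norm (basis_poly q n x) \<le> (r + 1) ^ n"
proof -
  have "norm (x - q ^ (k + 1)) \<le> r + 1" for k
  proof -
    have "norm (x - q ^ (k + 1)) \<le> norm x + norm q ^ (k + 1)"
      by (metis norm_triangle_ineq4 norm_power)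
    also have "\<dots> \<le> r + 1"
      using assms by (intro add_mono power_le_one) auto
    finally show ?thesis .
  qed
  then have "norm (basis_poly q n x) \<le> (\<Prod>k<n. r + 1)"
    unfolding basis_poly_def prod_norm[symmetric] by (intro prod_mono) auto
  then show ?thesis by simp
qed

section \<open>Series of decaying coefficients against functions of geometric growth\<close>

text \<open>The factor \<open>2 ^ n\<close> leaves room for the linear factor \<open>n\<close> in
  the bound on \<open>hecke_coeff\<close>.\<close>

definition triangular_decay :: "complex \<Rightarrow> (nat \<Rightarrow> complex) \<Rightarrow> bool" where
  "triangular_decay q c \<longleftrightarrow> (\<exists>A. \<forall>n. norm (c n) \<le> A * 2 ^ n * norm q ^ (n * (n - 1) div 2))"

lemma triangular_decayI:
  assumes "\<And>n. norm (c n) \<le> A * 2 ^ n * norm q ^ (n * (n - 1) div 2)"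
  shows "triangular_decay q c"
  using assms by (auto simp: triangular_decay_def)

lemma triangular_decay_add:
  assumes "triangular_decay q c" "triangular_decay q d"
  shows "triangular_decay q (\<lambda>n. c n + d n)"
proof -
  obtain A B where "\<And>n. norm (c n) \<le> A * 2 ^ n * norm q ^ (n * (n - 1) div 2)"
      "\<And>n. norm (d n) \<le> B * 2 ^ n * norm q ^ (n * (n - 1) div 2)"
    using assms unfolding triangular_decay_def by metis
  then have "norm (c n + d n) \<le> (A + B) * 2 ^ n * norm q ^ (n * (n - 1) div 2)" for n
    unfolding distrib_right by (rule norm_triangle_mono)
  then show ?thesis by (rule triangular_decayI)
qed

lemma triangular_decay_mult:
  assumes "triangular_decay q c" "\<And>n. norm (e n) \<le> B"
  shows "triangular_decay q (\<lambda>n. e n * c n)"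
proof -
  obtain A where A: "\<And>n. norm (c n) \<le> A * 2 ^ n * norm q ^ (n * (n - 1) div 2)"
    using assms(1) unfolding triangular_decay_def by metis
  have "norm (e n * c n) \<le> (B * A) * 2 ^ n * norm q ^ (n * (n - 1) div 2)" for n
    using mult_mono[OF assms(2)[of n] A[of n] order_trans[OF norm_ge_zero assms(2)] norm_ge_zero]
    by (simp add: norm_mult mult_ac)
  then show ?thesis by (rule triangular_decayI)
qed

text \<open>Remainders of the telescoped sums carry the coefficient with index \<open>Suc N\<close>,
  so the class must be closed under shifts.\<close>

lemma triangular_decay_Suc:
  assumes "norm q < 1" "triangular_decay q c"
  shows "triangular_decay q (\<lambda>n. c (Suc n))"
proof -
  obtain A where A: "\<And>n. norm (c n) \<le> A * 2 ^ n * norm q ^ (n * (n - 1) div 2)"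
    using assms(2) unfolding triangular_decay_def by metis
  have "0 \<le> A"
    using order_trans[OF norm_ge_zero A[of 0]] by simp
  have "norm (c (Suc n)) \<le> (2 * A) * 2 ^ n * norm q ^ (n * (n - 1) div 2)" for n
  proof -
    have "norm (c (Suc n)) \<le> A * 2 ^ Suc n * norm q ^ (n + n * (n - 1) div 2)"
      using A[of "Suc n"] unfolding diff_Suc_1 triangular_Suc .
    also have "\<dots> \<le> A * 2 ^ Suc n * norm q ^ (n * (n - 1) div 2)"
      using assms(1) \<open>0 \<le> A\<close> by (intro mult_left_mono power_decreasing) auto
    finally show ?thesis by simp
  qed
  then show ?thesis by (rule triangular_decayI)
qed

text \<open>The base \<open>r + 1\<close> bounds each factor \<open>x - q ^ (k + 1)\<close> on the
  disc of radius \<open>r\<close>; being at least 1, it also admits uniformly bounded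
  families.\<close>

definition geometric_growth :: "(nat \<Rightarrow> complex \<Rightarrow> complex) \<Rightarrow> bool" where
  "geometric_growth g \<longleftrightarrow>
     (\<forall>r\<ge>0. \<exists>B. \<forall>n x. norm x \<le> r \<longrightarrow> norm (g n x) \<le> B * (r + 1) ^ n)"

text \<open>On a disc the terms are dominated by a multiple of \<open>(2 * (r + 1)) ^ n\<close>
  times a triangular power of \<open>norm q\<close>. This one majorant yields convergence, vanishing
  remainders and continuity at 0.\<close>

lemma decay_growth_majorant:
  assumes "norm q < 1" "triangular_decay q c" "geometric_growth g" "0 \<le> r"
  obtains M :: "nat \<Rightarrow> real" where "summable M"
    and "\<And>n x. norm x \<le> r \<Longrightarrow> norm (c n * g n x) \<le> M n"
proof -
  obtain A where A: "\<And>n. norm (c n) \<le> A * 2 ^ n * norm q ^ (n * (n - 1) div 2)"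
    using assms(2) by (auto simp: triangular_decay_def)
  obtain B where B: "\<And>n x. norm x \<le> r \<Longrightarrow> norm (g n x) \<le> B * (r + 1) ^ n"
    using assms(3,4) unfolding geometric_growth_def by blast
  define M where "M n = A * B * ((2 * (r + 1)) ^ n * norm q ^ (n * (n - 1) div 2))" for n :: nat
  show thesis
  proof (rule that[of M])
    show "summable M"
      unfolding M_def using assms(1)
      by (intro summable_mult summable_power_times_triangular_power) auto
    fix n :: nat and x :: complex assume x: "norm x \<le> r"
    have "norm (c n * g n x) \<le> (A * 2 ^ n * norm q ^ (n * (n - 1) div 2)) * (B * (r + 1) ^ n)"
      unfolding norm_mult by (intro mult_mono A B x norm_ge_zero order_trans[OF norm_ge_zero A])
    also have "\<dots> = M n"
      by (simp only: M_def power_mult_distrib mult_ac)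
    finally show "norm (c n * g n x) \<le> M n" .
  qed
qed

lemma decay_growth_summable:
  assumes "norm q < 1" "triangular_decay q c" "geometric_growth g"
  shows "summable (\<lambda>n. c n * g n x)"
proof -
  obtain M where M: "summable M" "\<And>n y. norm y \<le> norm x \<Longrightarrow> norm (c n * g n y) \<le> M n"
    using decay_growth_majorant[OF assms norm_ge_zero] by metis
  show ?thesis
    by (intro summable_comparison_test'[OF M(1)] M(2)) auto
qed

lemma decay_growth_LIMSEQ_0:
  assumes "norm q < 1" "triangular_decay q c" "geometric_growth g"
  shows "(\<lambda>n. c n * g n x) \<longlonglongrightarrow> 0"
  by (rule summable_LIMSEQ_zero[OF decay_growth_summable[OF assms]])

text \<open>Tannery's theorem, with the majorant for the unit disc, exchanges the sum and the limit
  at 0.\<close>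

lemma decay_growth_isCont_0:
  assumes "norm q < 1" "triangular_decay q c" "geometric_growth g" "\<And>n. isCont (g n) 0"
  shows "isCont (\<lambda>x. \<Sum>n. c n * g n x) 0"
proof -
  obtain M where M: "summable M" "\<And>n y. norm y \<le> 1 \<Longrightarrow> norm (c n * g n y) \<le> M n"
    using decay_growth_majorant[OF assms(1-3) zero_le_one] by metis
  have "\<forall>\<^sub>F x in at (0::complex). norm x \<le> 1"
    using eventually_at_ball[of 1 0 UNIV] by (auto elim!: eventually_mono simp: dist_norm)
  from eventually_prodI[OF eventually_True this]
  have "\<forall>\<^sub>F (k, x) in sequentially \<times>\<^sub>F at 0. norm (c k * g k x) \<le> M k"
    by (rule eventually_mono) (use M(2) in auto)
  moreover have "((\<lambda>x. c n * g n x) \<longlongrightarrow> c n * g n 0) (at 0)" for n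
    using assms(4)[of n] by (intro tendsto_intros) (simp add: isCont_def)
  ultimately show ?thesis
    unfolding isCont_def using M(1)
    by (intro tannerys_theorem[THEN conjunct2, THEN conjunct2]) auto
qed

lemma isCont_qpoch_inf_0:
  assumes "norm q < 1"
  shows "isCont (\<lambda>x. qpoch_inf (x * z) q) 0"
proof -
  have "((\<lambda>x. x * z) \<longlongrightarrow> 0) (at 0)"
    by (rule tendsto_mult_left_zero) (rule tendsto_ident_at)
  from tendsto_qpoch_inf_0[OF assms this] show ?thesis
    by (simp add: isCont_def)
qed

lemma norm_mult_power_le:
  fixes q x :: complex
  assumes "norm q < 1"
  shows "norm (x * q ^ n) \<le> norm x"
  using assms by (simp add: norm_mult norm_power mult_left_le power_le_one)

section \<open>Basis functions and the remainders of telescoping\<close>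

definition basis_fun :: "complex \<Rightarrow> nat \<Rightarrow> complex \<Rightarrow> complex" where
  "basis_fun q n x = basis_poly q n x * qpoch_inf (x * q ^ n) q"

text \<open>This is \<open>basis_fun\<close> without the factor \<open>1 - x * q ^ n\<close>; the
  telescoped partial sums end in it.\<close>

definition boundary_fun :: "complex \<Rightarrow> nat \<Rightarrow> complex \<Rightarrow> complex" where
  "boundary_fun q n x = basis_poly q n x * qpoch_inf (x * q ^ Suc n) q"

lemma geometric_growth_basis_poly_mult:
  assumes "norm q < 1"
  shows "geometric_growth (\<lambda>n x. basis_poly q n x * qpoch_inf (x * q ^ f n) q)"
  unfolding geometric_growth_def
proof (intro allI impI exI)
  fix r :: real and n :: nat and x :: complex assume r: "0 \<le> r" and x: "norm x \<le> r"
  have "norm (basis_poly q n x) * norm (qpoch_inf (x * q ^ f n) q)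
      \<le> (r + 1) ^ n * exp (r / (1 - norm q))"
    using r by (intro mult_mono norm_basis_poly_le norm_qpoch_inf_le assms x
        order_trans[OF norm_mult_power_le]) auto
  then show "norm (basis_poly q n x * qpoch_inf (x * q ^ f n) q)
      \<le> exp (r / (1 - norm q)) * (r + 1) ^ n"
    by (simp add: norm_mult mult.commute)
qed

lemma geometric_growth_basis_fun: "norm q < 1 \<Longrightarrow> geometric_growth (basis_fun q)"
  unfolding basis_fun_def by (rule geometric_growth_basis_poly_mult)

lemma geometric_growth_boundary_fun: "norm q < 1 \<Longrightarrow> geometric_growth (boundary_fun q)"
  unfolding boundary_fun_def by (rule geometric_growth_basis_poly_mult)

lemma geometric_growth_qpoch_inf:
  assumes "norm q < 1"
  shows "geometric_growth (\<lambda>n x. qpoch_inf (- x * q ^ n) q)"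
  unfolding geometric_growth_def
proof (intro allI impI exI)
  fix r :: real and n :: nat and x :: complex assume r: "0 \<le> r" and x: "norm x \<le> r"
  have "norm (qpoch_inf (- x * q ^ n) q) \<le> exp (r / (1 - norm q)) * 1"
    using norm_mult_power_le[OF assms, of "- x" n] x by (simp add: norm_qpoch_inf_le[OF assms])
  also have "\<dots> \<le> exp (r / (1 - norm q)) * (r + 1) ^ n"
    using r by (intro mult_left_mono one_le_power) auto
  finally show "norm (qpoch_inf (- x * q ^ n) q) \<le> exp (r / (1 - norm q)) * (r + 1) ^ n" .
qed

lemma isCont_basis_fun_0:
  assumes "norm q < 1"
  shows "isCont (basis_fun q n) 0"
  unfolding basis_fun_def basis_poly_def
  by (intro continuous_intros isCont_qpoch_inf_0 assms)

text \<open>The common factor of \<open>basis_fun\<close> with index \<open>Suc n\<close> at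
  \<open>x\<close> and at \<open>x * q\<close> and of \<open>boundary_fun\<close> with indices
  \<open>n\<close> and \<open>Suc n\<close>. Dividing it out turns each telescoping step into a
  polynomial identity.\<close>

definition basis_core :: "complex \<Rightarrow> nat \<Rightarrow> complex \<Rightarrow> complex" where
  "basis_core q n x = basis_poly q n x * qpoch_inf (x * q ^ (n + 2)) q"

lemma basis_fun_Suc_scale:
  "basis_fun q (Suc n) (x * q) = q ^ Suc n * (x - 1) * basis_core q n x"
  unfolding basis_fun_def basis_core_def basis_poly_Suc_scale by (simp add: mult_ac)

lemma boundary_fun_Suc:
  "boundary_fun q (Suc n) x = (x - q ^ Suc n) * basis_core q n x"
  unfolding boundary_fun_def basis_core_def basis_poly_Suc by (simp add: mult_ac)

lemma boundary_fun_conv_core: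
  assumes "norm q < 1"
  shows "boundary_fun q n x = (1 - x * q ^ Suc n) * basis_core q n x"
  using qpoch_inf_unfold[OF assms, of "x * q ^ Suc n"]
  unfolding boundary_fun_def basis_core_def by (simp add: mult_ac)

lemma basis_fun_Suc:
  assumes "norm q < 1"
  shows "basis_fun q (Suc n) x = (x - q ^ Suc n) * (1 - x * q ^ Suc n) * basis_core q n x"
  using qpoch_inf_unfold[OF assms, of "x * q ^ Suc n"]
  unfolding basis_fun_def basis_core_def basis_poly_Suc by (simp add: mult_ac)

section \<open>The coefficients and their decay\<close>

definition theta_coeff :: "complex \<Rightarrow> nat \<Rightarrow> complex" where
  "theta_coeff q n = (if n = 0 then 1 else 2 * q ^ (n * (n - 1) div 2))"

text \<open>
  \<open>hecke_coeff q n\<close> is $(-1)^{n-1} q^{3n(n-1)/2} \sum_{|j|<n} (-1)^j q^{-j^2}$; the recursion is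
  all that the telescoping arguments need.
\<close>

fun hecke_coeff :: "complex \<Rightarrow> nat \<Rightarrow> complex" where
  "hecke_coeff q 0 = 0"
| "hecke_coeff q (Suc n) = theta_coeff q n * q ^ (2 * n) - q ^ (3 * n) * hecke_coeff q n"

lemma theta_coeff_0 [simp]: "theta_coeff q 0 = 1"
  by (simp add: theta_coeff_def)

text \<open>The recursion starts at index 1: from index 0 to 1 the coefficient doubles
  instead.\<close>

lemma theta_coeff_Suc_Suc: "theta_coeff q (Suc (Suc n)) = q ^ Suc n * theta_coeff q (Suc n)"
  using triangular_Suc[of "Suc n"] by (simp add: theta_coeff_def power_add)

lemma norm_theta_coeff_le: "norm (theta_coeff q n) \<le> 2 * norm q ^ (n * (n - 1) div 2)"
  by (simp add: theta_coeff_def norm_mult norm_power)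

lemma triangular_decay_theta_coeff: "triangular_decay q (theta_coeff q)"
proof (rule triangular_decayI)
  fix n
  have "2 * norm q ^ (n * (n - 1) div 2) \<le> 2 * 2 ^ n * norm q ^ (n * (n - 1) div 2)"
    by (intro mult_right_mono) auto
  with norm_theta_coeff_le
  show "norm (theta_coeff q n) \<le> 2 * 2 ^ n * norm q ^ (n * (n - 1) div 2)"
    by (rule order_trans)
qed

text \<open>Both terms of the recursion keep a factor of norm at most \<open>norm q ^ n\<close>,
  just what raises the triangular exponent, so every step adds 2 to the constant.\<close>

lemma norm_hecke_coeff_le:
  assumes "norm q < 1"
  shows "norm (hecke_coeff q n) \<le> 2 * real n * norm q ^ (n * (n - 1) div 2)"
proof (induction n)
  case (Suc n)
  let ?r = "norm q" and ?t = "n * (n - 1) div 2"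
  have "norm (hecke_coeff q (Suc n))
      \<le> norm (theta_coeff q n) * ?r ^ (2 * n) + ?r ^ (3 * n) * norm (hecke_coeff q n)"
    by (simp add: norm_mult norm_power order_trans[OF norm_triangle_ineq4])
  also have "\<dots> \<le> (2 * ?r ^ ?t) * ?r ^ n + ?r ^ n * (2 * real n * ?r ^ ?t)"
    using assms by (intro add_mono mult_mono norm_theta_coeff_le Suc power_decreasing) auto
  also have "\<dots> = 2 * real (Suc n) * ?r ^ (n + ?t)"
    by (simp add: power_add algebra_simps)
  finally show ?case
    unfolding diff_Suc_1 triangular_Suc .
qed simp

lemma triangular_decay_hecke_coeff:
  assumes "norm q < 1"
  shows "triangular_decay q (hecke_coeff q)"
proof (rule triangular_decayI)
  fix n
  have "real n \<le> 2 ^ n"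
    by (rule less_imp_le, rule of_nat_less_two_power)
  then have "2 * real n * norm q ^ (n * (n - 1) div 2) \<le> 2 * 2 ^ n * norm q ^ (n * (n - 1) div 2)"
    by (intro mult_right_mono) auto
  with norm_hecke_coeff_le[OF assms]
  show "norm (hecke_coeff q n) \<le> 2 * 2 ^ n * norm q ^ (n * (n - 1) div 2)"
    by (rule order_trans)
qed

lemma norm_power_le_1: "norm q < 1 \<Longrightarrow> norm (q ^ n) \<le> 1" for q :: complex
  by (simp add: norm_power power_le_one)

lemma norm_add_power_le_2:
  fixes q :: complex
  assumes "norm q < 1"
  shows "norm (1 + q ^ n) \<le> 2"
  using norm_triangle_ineq[of 1 "q ^ n"] norm_power_le_1[OF assms, of n] by simp

lemma norm_diff_power_le_2:
  fixes q :: complex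
  assumes "norm q < 1"
  shows "norm (1 - q ^ n) \<le> 2"
  using norm_triangle_ineq4[of 1 "q ^ n"] norm_power_le_1[OF assms, of n] by simp

text \<open>The coefficient \<open>(1 + q^n) * theta_coeff q n + (1 - q^(2 * n)) * hecke_coeff q
  n\<close> of the second right-hand side, less \<open>theta_coeff q n\<close>. Thus R is the sum of
  \<open>theta_series\<close> and \<open>rest_series\<close>.\<close>

definition rest_coeff :: "complex \<Rightarrow> nat \<Rightarrow> complex" where
  "rest_coeff q n = q ^ n * theta_coeff q n + (1 - q ^ (2 * n)) * hecke_coeff q n"

lemma triangular_decay_rest_coeff:
  assumes "norm q < 1"
  shows "triangular_decay q (rest_coeff q)"
proof -
  show ?thesis
    unfolding rest_coeff_def
    by (intro triangular_decay_add triangular_decay_mult[OF triangular_decay_theta_coeff norm_power_le_1]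
        triangular_decay_mult[OF triangular_decay_hecke_coeff norm_diff_power_le_2] assms)
qed

section \<open>Telescoping partial sums\<close>

text \<open>After division by \<open>basis_core\<close>, the induction step reads \<open>y * (x^2 -
  1) - (x - y) * (1 - x * y) + x * (1 - x * y) = x * y * (x - y)\<close> with
  \<open>y = q ^ Suc N\<close>.\<close>

lemma theta_partial_sum:
  assumes "norm q < 1"
  shows "(\<Sum>n\<le>N. theta_coeff q n * ((1 + x) * basis_fun q n (x * q) - basis_fun q n x))
    = x * (theta_coeff q (Suc N) * boundary_fun q N x)"
proof (induction N)
  case 0
  show ?case
    by (simp add: qpoch_inf_unfold[OF assms, of x] basis_fun_def boundary_fun_def theta_coeff_def algebra_simps)
next
  case (Suc N)
  define y where "y = q ^ Suc N"
  show ?case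
    unfolding sum.atMost_Suc Suc theta_coeff_Suc_Suc[of q N] boundary_fun_Suc
      boundary_fun_conv_core[OF assms] basis_fun_Suc[OF assms] basis_fun_Suc_scale y_def[symmetric]
    by (simp add: algebra_simps)
qed

text \<open>The recursion of \<open>hecke_coeff\<close> makes the step a polynomial identity in
  \<open>x\<close>, \<open>y = q ^ Suc N\<close>, the two coefficients with index
  \<open>Suc N\<close> and \<open>basis_core\<close>.\<close>

lemma rest_partial_sum:
  assumes "norm q < 1"
  shows "(\<Sum>n\<le>N. rest_coeff q n * (basis_fun q n (x * q) - (1 - x) * basis_fun q n x)
        - x * (theta_coeff q n * basis_fun q n (x * q)))
    = x * (1 - x) * (hecke_coeff q (Suc N) * boundary_fun q N x)"
proof (induction N)
  case 0
  show ?case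
    by (simp add: qpoch_inf_unfold[OF assms, of x] basis_fun_def boundary_fun_def rest_coeff_def algebra_simps)
next
  case (Suc N)
  define y where "y = q ^ Suc N"
  have y: "q ^ (2 * Suc N) = y * y" "q ^ (3 * Suc N) = y * (y * y)"
    unfolding y_def by (simp_all only: mult_2 power_add numeral_3_eq_3 mult_Suc mult_0 add_0_right)
  show ?case
    unfolding sum.atMost_Suc Suc
    unfolding hecke_coeff.simps(2)[of q "Suc N"] rest_coeff_def boundary_fun_Suc
      boundary_fun_conv_core[OF assms] basis_fun_Suc[OF assms] basis_fun_Suc_scale
      y y_def[symmetric]
    by algebra
qed

section \<open>Solving scaling equations by iteration towards the origin\<close>

lemma power_scale_LIMSEQ_0:
  fixes q x :: complex
  assumes "norm q < 1"
  shows "(\<lambda>n. x * q ^ n) \<longlonglongrightarrow> 0"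
  by (intro tendsto_mult_right_zero LIMSEQ_power_zero assms)

lemma scaling_contraction_solution:
  assumes "norm q < 1" "isCont h 0" "\<And>x. h x = (1 - x) * h (x * q)"
  shows "h x = qpoch_inf x q * h 0"
proof (rule LIMSEQ_unique)
  have eq: "h x = qpoch x q n * h (x * q ^ n)" for n
  proof (induction n)
    case (Suc n)
    then show ?case
      using assms(3)[of "x * q ^ n"] by (simp add: qpoch_Suc mult_ac)
  qed simp
  show "(\<lambda>n. h x) \<longlonglongrightarrow> h x" by simp
  have "(\<lambda>n. qpoch x q n * h (x * q ^ n)) \<longlonglongrightarrow> qpoch_inf x q * h 0"
    by (intro tendsto_mult qpoch_LIMSEQ assms isCont_tendsto_compose[OF assms(2)] power_scale_LIMSEQ_0)
  then show "(\<lambda>n. h x) \<longlonglongrightarrow> qpoch_inf x q * h 0"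
    using eq by simp
qed

lemma scaling_expansion_zero:
  assumes "norm q < 1" "isCont h 0" "\<And>x. h (x * q) = (1 - x) * h x"
    "qpoch_inf x q \<noteq> 0"
  shows "h x = 0"
proof -
  have eq: "h (y * q ^ n) = qpoch y q n * h y" for y n
  proof (induction n)
    case (Suc n)
    then show ?case
      using assms(3)[of "y * q ^ n"] by (simp add: qpoch_Suc mult_ac)
  qed simp
  have lim: "(\<lambda>n. h (y * q ^ n)) \<longlonglongrightarrow> h 0" for y
    by (intro isCont_tendsto_compose[OF assms(2)] power_scale_LIMSEQ_0 assms)
  have h0: "qpoch_inf y q * h y = h 0" for y
    using LIMSEQ_unique[OF lim[of y, unfolded eq] tendsto_mult_right[OF qpoch_LIMSEQ[OF assms(1)]]]
    by simp
  \<comment> \<open>The factor \<open>1 - x\<close> vanishes at 1. With \<open>y = q\<close> the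
    limit relation then forces \<open>h 0 = 0\<close>.\<close>
  have "h q = 0"
    using assms(3)[of 1] by simp
  then show ?thesis
    using h0[of q] h0[of x] assms(4) by simp
qed

section \<open>The three series H, R - H and F and their scaling equations\<close>

definition theta_series :: "complex \<Rightarrow> complex \<Rightarrow> complex" where
  "theta_series q x = (\<Sum>n. theta_coeff q n * basis_fun q n x)"

definition rest_series :: "complex \<Rightarrow> complex \<Rightarrow> complex" where
  "rest_series q x = (\<Sum>n. rest_coeff q n * basis_fun q n x)"

text \<open>The sum on the left-hand side multiplied by \<open>(-x; q)_inf\<close>, which clears the
  denominators \<open>(-x; q)_n\<close>.\<close>

definition tail_series :: "complex \<Rightarrow> complex \<Rightarrow> complex" where
  "tail_series q x = (\<Sum>n. q ^ (n * (n - 1) div 2) * qpoch_inf (- x * q ^ n) q)"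

context
  fixes q :: complex
  assumes q: "norm q < 1"
begin

lemma theta_series_sums: "(\<lambda>n. theta_coeff q n * basis_fun q n x) sums theta_series q x"
  unfolding theta_series_def
  by (intro summable_sums decay_growth_summable[OF q] triangular_decay_theta_coeff
      geometric_growth_basis_fun q)

lemma rest_series_sums: "(\<lambda>n. rest_coeff q n * basis_fun q n x) sums rest_series q x"
  unfolding rest_series_def
  by (intro summable_sums decay_growth_summable[OF q] triangular_decay_rest_coeff
      geometric_growth_basis_fun q)

lemma triangular_decay_triangular_power: "triangular_decay q (\<lambda>n. q ^ (n * (n - 1) div 2))"
proof (rule triangular_decayI)
  fix n
  have "1 * norm q ^ (n * (n - 1) div 2) \<le> (1 * 2 ^ n) * norm q ^ (n * (n - 1) div 2)"
    by (intro mult_right_mono) auto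
  then show "norm (q ^ (n * (n - 1) div 2)) \<le> 1 * 2 ^ n * norm q ^ (n * (n - 1) div 2)"
    by (simp only: norm_power mult_1_left)
qed

lemma tail_series_sums:
  "(\<lambda>n. q ^ (n * (n - 1) div 2) * qpoch_inf (- x * q ^ n) q) sums tail_series q x"
  unfolding tail_series_def
  by (intro summable_sums decay_growth_summable[OF q] triangular_decay_triangular_power
      geometric_growth_qpoch_inf q)

lemma isCont_theta_series: "isCont (theta_series q) 0"
  unfolding theta_series_def
  by (intro decay_growth_isCont_0[OF q] triangular_decay_theta_coeff
      geometric_growth_basis_fun isCont_basis_fun_0 q)

lemma isCont_rest_series: "isCont (rest_series q) 0"
  unfolding rest_series_def
  by (intro decay_growth_isCont_0[OF q] triangular_decay_rest_coeff
      geometric_growth_basis_fun isCont_basis_fun_0 q)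

lemma isCont_tail_series: "isCont (tail_series q) 0"
  unfolding tail_series_def
proof (rule decay_growth_isCont_0[OF q triangular_decay_triangular_power geometric_growth_qpoch_inf[OF q]])
  show "isCont (\<lambda>x. qpoch_inf (- x * q ^ n) q) 0" for n
    using isCont_qpoch_inf_0[OF q, of "- (q ^ n)"] by simp
qed

lemma theta_series_scale: "theta_series q x = (1 + x) * theta_series q (x * q)"
proof -
  let ?f = "\<lambda>n. theta_coeff q n * ((1 + x) * basis_fun q n (x * q) - basis_fun q n x)"
  have "?f sums ((1 + x) * theta_series q (x * q) - theta_series q x)"
    using sums_diff[OF sums_mult[OF theta_series_sums[of "x * q"], of "1 + x"] theta_series_sums[of x]]
    by (simp add: algebra_simps)
  moreover have "?f sums (x * 0)"
    \<comment> \<open>\<open>sums_def_le\<close> takes partial sums up to and including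
      \<open>N\<close>, matching the closed form, whose remainder tends to 0.\<close>
    unfolding sums_def_le theta_partial_sum[OF q]
    by (intro tendsto_intros decay_growth_LIMSEQ_0[OF q] triangular_decay_Suc[OF q]
        triangular_decay_theta_coeff geometric_growth_boundary_fun q)
  ultimately show ?thesis
    using sums_unique2 by fastforce
qed

lemma rest_series_scale: "rest_series q (x * q) = (1 - x) * rest_series q x + x * theta_series q (x * q)"
proof -
  let ?f = "\<lambda>n. rest_coeff q n * (basis_fun q n (x * q) - (1 - x) * basis_fun q n x)
        - x * (theta_coeff q n * basis_fun q n (x * q))"
  have "?f sums (rest_series q (x * q) - (1 - x) * rest_series q x - x * theta_series q (x * q))"
    using sums_diff[OF sums_diff[OF rest_series_sums[of "x * q"]
          sums_mult[OF rest_series_sums[of x], of "1 - x"]]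
        sums_mult[OF theta_series_sums[of "x * q"], of x]]
    by (simp add: algebra_simps)
  moreover have "?f sums (x * (1 - x) * 0)"
    unfolding sums_def_le rest_partial_sum[OF q]
    by (intro tendsto_intros decay_growth_LIMSEQ_0[OF q] triangular_decay_Suc[OF q]
        triangular_decay_hecke_coeff geometric_growth_boundary_fun q)
  ultimately have "rest_series q (x * q) - (1 - x) * rest_series q x - x * theta_series q (x * q) = 0"
    using sums_unique2 by fastforce
  then show ?thesis by (simp add: algebra_simps)
qed

text \<open>Splitting off the first factor \<open>1 + x * q ^ n\<close> of
  \<open>(-x q^n; q)_inf\<close> breaks each term into the same term at \<open>x * q\<close> and
  \<open>x\<close> times the next term at \<open>x\<close>.\<close>

lemma tail_series_scale: "tail_series q (x * q) = (1 - x) * tail_series q x + x * qpoch_inf (- x) q"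
proof -
  let ?g = "\<lambda>n. q ^ (n * (n - 1) div 2) * qpoch_inf (- x * q ^ n) q"
  have "?g n = q ^ (n * (n - 1) div 2) * qpoch_inf (- (x * q) * q ^ n) q + x * ?g (Suc n)" for n
  proof -
    define w where "w = q ^ (n * (n - 1) div 2)"
    define Q where "Q = qpoch_inf (- x * q ^ n * q) q"
    have 1: "?g (Suc n) = q ^ n * w * Q"
      unfolding diff_Suc_1 triangular_Suc w_def Q_def by (simp only: power_add power_Suc mult_ac)
    have 2: "qpoch_inf (- x * q ^ n) q = (1 + x * q ^ n) * Q"
      using qpoch_inf_unfold[OF q, of "- x * q ^ n"] by (simp add: Q_def)
    have 3: "qpoch_inf (- (x * q) * q ^ n) q = Q"
      by (simp add: Q_def mult_ac)
    show ?thesis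
      unfolding 1 2 3 w_def[symmetric] by (simp add: algebra_simps)
  qed
  moreover have "(\<lambda>n. q ^ (n * (n - 1) div 2) * qpoch_inf (- (x * q) * q ^ n) q + x * ?g (Suc n))
      sums (tail_series q (x * q) + x * (tail_series q x - qpoch_inf (- x) q))"
    using tail_series_sums[of x]
    by (intro sums_add tail_series_sums sums_mult sums_Suc_iff[of ?g, THEN iffD2]) simp
  ultimately have "?g sums (tail_series q (x * q) + x * (tail_series q x - qpoch_inf (- x) q))"
    by simp
  then have "tail_series q x = tail_series q (x * q) + x * (tail_series q x - qpoch_inf (- x) q)"
    using tail_series_sums sums_unique2 by blast
  then show ?thesis by (simp add: algebra_simps)
qed

text \<open>The factor \<open>x - q\<close> vanishes at \<open>x = q\<close>, so a series in
  \<open>basis_fun\<close> reduces there to its first term.\<close>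

lemma basis_fun_q: "basis_fun q n q = (if n = 0 then qpoch_inf q q else 0)"
proof (cases n)
  case (Suc m)
  have "basis_poly q (Suc m) q = 0" for m
    by (induction m) (auto simp: basis_poly_Suc)
  then show ?thesis using Suc by (simp add: basis_fun_def)
qed (simp add: basis_fun_def)

text \<open>Iterating the scaling equation gives \<open>theta_series q 0 * (-x; q)_inf\<close>;
  evaluation at \<open>q\<close> eliminates the unknown value at 0.\<close>

lemma theta_series_eq: "qpoch_inf (- q) q * theta_series q x = qpoch_inf q q * qpoch_inf (- x) q"
proof -
  have eq: "theta_series q (- x) = qpoch_inf x q * theta_series q 0" for x
  proof -
    have "isCont (\<lambda>x. theta_series q (- x)) 0"
      by (rule isCont_o2[where f = uminus and g = "theta_series q"])
         (simp_all add: isCont_theta_series)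
    moreover have "theta_series q (- y) = (1 - y) * theta_series q (- (y * q))" for y
      using theta_series_scale[of "- y"] by (simp only: mult_minus_left diff_conv_add_uminus)
    ultimately have "theta_series q (- x) = qpoch_inf x q * theta_series q (- 0)"
      by (rule scaling_contraction_solution[OF q])
    then show ?thesis
      by (simp only: minus_zero)
  qed
  have "(\<lambda>n. if n = 0 then qpoch_inf q q else 0) sums qpoch_inf q q"
    using sums_single[of 0 "\<lambda>n. qpoch_inf q q"] by simp
  moreover have "(\<lambda>n. theta_coeff q n * basis_fun q n q) = (\<lambda>n. if n = 0 then qpoch_inf q q else 0)"
    by (auto simp: basis_fun_q)
  ultimately have "theta_series q q = qpoch_inf q q"
    using theta_series_sums[of q] sums_unique2 by metis
  then show ?thesis
    using eq[of "- q"] eq[of "- x"] by simp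
qed

lemma theta_plus_rest_series_eq:
  assumes "qpoch_inf x q \<noteq> 0" "qpoch_inf (- q) q \<noteq> 0"
  shows "theta_series q x + rest_series q x = qpoch_inf q q / qpoch_inf (- q) q * tail_series q x"
proof -
  define C where "C = qpoch_inf q q / qpoch_inf (- q) q"
  define h where "h y = theta_series q y + rest_series q y - C * tail_series q y" for y
  have "h x = 0"
  proof (rule scaling_expansion_zero[OF q _ _ assms(1)])
    show "isCont h 0"
      unfolding h_def
      by (intro continuous_intros isCont_theta_series isCont_rest_series isCont_tail_series)
    fix y
    \<comment> \<open>The product formula makes the inhomogeneous terms of the scaling equations
      cancel in \<open>h\<close>.\<close>
    have "theta_series q y = C * qpoch_inf (- y) q"
      using theta_series_eq[of y] assms(2) by (simp add: C_def field_simps)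
    with theta_series_scale[of y] show "h (y * q) = (1 - y) * h y"
      unfolding h_def rest_series_scale tail_series_scale by algebra
  qed
  then show ?thesis by (simp add: h_def C_def)
qed

end

section \<open>Explicit double sums for the recursive coefficients\<close>

text \<open>From \<open>n\<close> to \<open>Suc n\<close> the old summands gain
  \<open>q ^ (3 * Suc n)\<close> and the outer sign flips, while the two equal end terms
  \<open>j = Suc n\<close> and \<open>j = - Suc n\<close> supply the theta coefficient.\<close>

lemma hecke_coeff_eq_sum:
  assumes "q \<noteq> 0"
  shows "hecke_coeff q (Suc n) =
    (- 1) ^ n * (\<Sum>j\<in>{- int n..int n}. (- 1) powi j * q powi (3 * int (n + 1) * int n div 2 - j ^ 2))"
proof (induction n)
  case 0
  show ?case by simp
next
  case (Suc n)
  let ?t = "\<lambda>n j. (- 1) powi j * q powi (3 * int (n + 1) * int n div 2 - j ^ 2)"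
  let ?m = "int (Suc n)"
  have step: "3 * int (Suc n + 1) * int (Suc n) div 2 = 3 * int (Suc n) + 3 * int (n + 1) * int n div 2"
  proof -
    have "3 * int (Suc n + 1) * int (Suc n) = 3 * int (n + 1) * int n + 2 * (3 * int (Suc n))"
      by (simp add: algebra_simps)
    then show ?thesis by simp
  qed
  have ends: "3 * int (Suc n + 1) * int (Suc n) div 2 - ?m ^ 2 = int (Suc n * n div 2 + 2 * Suc n)"
  proof -
    \<comment> \<open>Writing \<open>Suc n * n\<close> as \<open>2 * k\<close> makes both divisions
      by 2 exact.\<close>
    have "even (Suc n * n)" by simp
    then obtain k where k: "Suc n * n = 2 * k" by (elim evenE)
    then have "int (Suc n) * int n = 2 * int k" by (metis of_nat_mult of_nat_numeral)
    then have "3 * int (Suc n + 1) * int (Suc n) = 2 * (3 * int k + 3 * int (Suc n))"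
        "?m ^ 2 = 2 * int k + int (Suc n)"
      by (simp_all add: algebra_simps power2_eq_square)
    then show ?thesis using k by simp
  qed
  have set: "{- ?m..?m} = insert ?m (insert (- ?m) {- int n..int n})" by auto
  have "(\<Sum>j\<in>{- ?m..?m}. ?t (Suc n) j)
      = ?t (Suc n) ?m + (?t (Suc n) (- ?m) + (\<Sum>j\<in>{- int n..int n}. ?t (Suc n) j))"
    unfolding set by (subst sum.insert; simp)+
  also have "(\<Sum>j\<in>{- int n..int n}. ?t (Suc n) j) = q ^ (3 * Suc n) * (\<Sum>j\<in>{- int n..int n}. ?t n j)"
    unfolding sum_distrib_left step
  proof (rule sum.cong[OF refl])
    fix j
    have "q powi (3 * int (Suc n) + 3 * int (n + 1) * int n div 2 - j ^ 2)
        = q powi int (3 * Suc n) * q powi (3 * int (n + 1) * int n div 2 - j ^ 2)"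
      by (subst power_int_add[symmetric]) (use assms in \<open>auto simp: algebra_simps\<close>)
    then show "(- 1) powi j * q powi (3 * int (Suc n) + 3 * int (n + 1) * int n div 2 - j ^ 2)
        = q ^ (3 * Suc n) * ?t n j"
      by (simp only: power_int_of_nat mult_ac)
  qed
  also have "?t (Suc n) ?m = (- 1) ^ Suc n * q ^ (Suc n * n div 2 + 2 * Suc n)"
    unfolding ends power_int_of_nat ..
  also have "?t (Suc n) (- ?m) = (- 1) ^ Suc n * q ^ (Suc n * n div 2 + 2 * Suc n)"
    unfolding power2_minus ends power_int_of_nat power_int_minus
    by (simp flip: power_inverse)
  finally have sum: "(\<Sum>j\<in>{- ?m..?m}. ?t (Suc n) j)
      = (- 1) ^ Suc n * q ^ (Suc n * n div 2 + 2 * Suc n)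
        + ((- 1) ^ Suc n * q ^ (Suc n * n div 2 + 2 * Suc n)
        + q ^ (3 * Suc n) * (\<Sum>j\<in>{- int n..int n}. ?t n j))" .
  have sign: "(- 1) ^ Suc n * (- 1) ^ Suc n = (1::complex)"
    by (simp flip: power_mult_distrib)
  have theta: "theta_coeff q (Suc n) = 2 * q ^ (Suc n * n div 2)"
    unfolding theta_coeff_def by simp
  define s where "s = (- 1 :: complex) ^ Suc n"
  have s: "s * s = 1" "(- 1) ^ n = - s"
    unfolding s_def using sign by simp_all
  have "2 * A * B - C * (- s * S) = s * (s * (A * B) + (s * (A * B) + C * S))" for A B C S
    using s(1) by algebra
  then show ?case
    unfolding hecke_coeff.simps(2)[of q "Suc n"] Suc sum theta power_add s_def[symmetric] s(2) .
qed

text \<open>Multiplication by \<open>q ^ (2 * n)\<close> turns the inner sum of the first formula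
  into that of \<open>hecke_coeff q (Suc n)\<close>; the recursion then permits cancelling this
  power.\<close>

lemma hecke_coeff_eq_sum':
  assumes "q \<noteq> 0"
  shows "(\<Sum>j\<in>{- int n..int n}. (- 1) powi (int n + j) * q powi ((3 * int n ^ 2 - int n) div 2 - j ^ 2))
    = theta_coeff q n - q ^ n * hecke_coeff q n" (is "?G = _")
proof -
  have e: "int (2 * n) + ((3 * int n ^ 2 - int n) div 2 - j ^ 2) = 3 * int (n + 1) * int n div 2 - j ^ 2" for j
  proof -
    have "3 * int (n + 1) * int n = 3 * int n ^ 2 - int n + 2 * int (2 * n)"
      by (simp add: algebra_simps power2_eq_square)
    then show ?thesis by simp
  qed
  have "q ^ (2 * n) * ?G = hecke_coeff q (Suc n)"
    unfolding hecke_coeff_eq_sum[OF assms] sum_distrib_left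
  proof (rule sum.cong[OF refl])
    fix j
    have "q powi (3 * int (n + 1) * int n div 2 - j ^ 2)
        = q ^ (2 * n) * q powi ((3 * int n ^ 2 - int n) div 2 - j ^ 2)"
      unfolding e[symmetric] using assms by (simp only: power_int_add power_int_of_nat simp_thms)
    moreover have "(- 1 :: complex) powi (int n + j) = (- 1) ^ n * (- 1) powi j"
      by (simp add: power_int_add)
    ultimately show "q ^ (2 * n) * ((- 1) powi (int n + j) * q powi ((3 * int n ^ 2 - int n) div 2 - j ^ 2))
        = (- 1) ^ n * ((- 1) powi j * q powi (3 * int (n + 1) * int n div 2 - j ^ 2))"
      by (simp only: mult_ac)
  qed
  also have "\<dots> = q ^ (2 * n) * (theta_coeff q n - q ^ n * hecke_coeff q n)"
    by (simp add: algebra_simps flip: power_add)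
  finally show ?thesis
    using assms by simp
qed

section \<open>Both expansions of the left-hand side\<close>

text \<open>In \<open>L\<close> the product \<open>(-a; q)_inf\<close> is moved into the sum, so a
  zero of some \<open>(-a; q)_n\<close> does no harm. Sums from 1 are shifted to start at 0, and
  convergence is asserted along with every value.\<close>

theorem theorem1p9:
  fixes q a :: complex
  assumes hq0: "0 < norm q" and hq1: "norm q < 1"
    and ha: "\<forall>m::nat. a \<noteq> inverse (q ^ m)"
  defines "L \<equiv> qpoch_inf q q / (qpoch_inf a q * qpoch_inf (- q) q) *
                 (\<Sum>n. q ^ (n * (n - 1) div 2) * qpoch_inf (- a * q ^ n) q)"
  shows "summable (\<lambda>n::nat. q ^ (n * (n - 1) div 2) * qpoch_inf (- a * q ^ n) q)
    \<and> (\<lambda>n::nat. \<Sum>j\<in>{- int n..int n}.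
          (-1) powi (int n + j) * q powi ((3 * int n ^ 2 - int n) div 2 - j ^ 2)
          * ((\<Prod>k<n. a - q ^ (k + 1)) / qpoch a q n)
          * (1 + q ^ n + (1 + q ^ (n + 1)) * (q ^ (2 * n) * (a - q ^ (n + 1)) / (1 - a * q ^ n))))
       sums L
    \<and> summable (\<lambda>n::nat. (1 + q ^ (n + 1)) * ((\<Prod>k<n+1. a - q ^ (k + 1)) / qpoch a q (n + 1))
                      * q ^ ((n + 1) * n div 2))
    \<and> summable (\<lambda>n::nat. (1 - q ^ (2 * (n + 1)))
                      * ((\<Prod>k<n+1. - (a - q ^ (k + 1))) / qpoch a q (n + 1))
                      * (\<Sum>j\<in>{- int n..int n}. (-1) powi j * q powi (3 * int (n + 1) * int n div 2 - j ^ 2)))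
    \<and> L = 2 + 2 * (\<Sum>n. (1 + q ^ (n + 1)) * ((\<Prod>k<n+1. a - q ^ (k + 1)) / qpoch a q (n + 1))
                      * q ^ ((n + 1) * n div 2))
          - (\<Sum>n. (1 - q ^ (2 * (n + 1)))
                      * ((\<Prod>k<n+1. - (a - q ^ (k + 1))) / qpoch a q (n + 1))
                      * (\<Sum>j\<in>{- int n..int n}. (-1) powi j * q powi (3 * int (n + 1) * int n div 2 - j ^ 2)))"
proof -
  have q0: "q \<noteq> 0"
    using hq0 by auto
  have fac: "a * q ^ k \<noteq> 1" for k
    using ha q0 by (metis inverse_unique mult.commute inverse_inverse_eq)
  have minus_fac: "- q * q ^ k \<noteq> 1" for k
  proof -
    have "norm (- q * q ^ k) \<le> norm (- q)"
      by (rule norm_mult_power_le[OF hq1])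
    also have "\<dots> < 1"
      using hq1 by simp
    finally show ?thesis
      using norm_one less_irrefl by metis
  qed
  have a_inf: "qpoch_inf a q \<noteq> 0" and mq_inf: "qpoch_inf (- q) q \<noteq> 0"
    by (rule qpoch_inf_nonzero[OF hq1 fac], rule qpoch_inf_nonzero[OF hq1 minus_fac])
  have a_fin: "qpoch a q n \<noteq> 0" for n
    using a_inf qpoch_inf_split[OF hq1, of a n] by auto
  define P where "P n = basis_poly q n a / qpoch a q n" for n
  have P_eq: "P n = basis_fun q n a / qpoch_inf a q" for n
    using a_inf a_fin[of n] qpoch_inf_split[OF hq1, of a n]
    by (auto simp: P_def basis_fun_def field_simps)
  have P_Suc: "P n * ((a - q ^ (n + 1)) / (1 - a * q ^ n)) = P (Suc n)" for n
    by (simp add: P_def basis_poly_Suc qpoch_Suc)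
  have summable_P: "summable (\<lambda>n. c n * P n)" if "triangular_decay q c" for c
    using summable_divide[OF decay_growth_summable[OF hq1 that geometric_growth_basis_fun[OF hq1]], of a "qpoch_inf a q"]
    by (simp add: P_eq)
  \<comment> \<open>\<open>A\<close> and \<open>B\<close> are the two parts of the second expansion;
    \<open>V\<close> is the sequence whose differences separate the two right-hand sides.\<close>
  define A where "A n = (1 + q ^ n) * theta_coeff q n * P n" for n
  define B where "B n = (1 - q ^ (2 * n)) * hecke_coeff q n * P n" for n
  define V where "V n = (1 + q ^ n) * hecke_coeff q n * P n" for n
  have A: "summable A"
    unfolding A_def by (rule summable_P triangular_decay_mult triangular_decay_theta_coeff
        norm_add_power_le_2 hq1)+
  have B: "summable B"
    unfolding B_def by (rule summable_P triangular_decay_mult triangular_decay_hecke_coeff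
        norm_diff_power_le_2 hq1)+
  have "summable V"
    unfolding V_def by (rule summable_P triangular_decay_mult triangular_decay_hecke_coeff
        norm_add_power_le_2 hq1)+
  then have V: "V \<longlonglongrightarrow> 0"
    by (rule summable_LIMSEQ_zero)
  have tail: "summable (\<lambda>n::nat. q ^ (n * (n - 1) div 2) * qpoch_inf (- a * q ^ n) q)"
    using tail_series_sums[OF hq1] by (rule sums_summable)
  have "L = (theta_series q a + rest_series q a) / qpoch_inf a q"
    unfolding L_def tail_series_def[symmetric] theta_plus_rest_series_eq[OF hq1 a_inf mq_inf] by simp
  moreover have "(\<lambda>n. (theta_coeff q n * basis_fun q n a + rest_coeff q n * basis_fun q n a) / qpoch_inf a q)
      sums ((theta_series q a + rest_series q a) / qpoch_inf a q)"
    by (intro sums_divide sums_add theta_series_sums rest_series_sums hq1)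
  moreover have "(theta_coeff q n * basis_fun q n a + rest_coeff q n * basis_fun q n a) / qpoch_inf a q
      = A n + B n" for n
    by (simp add: A_def B_def P_eq rest_coeff_def algebra_simps add_divide_distrib diff_divide_distrib)
  ultimately have AB: "(\<lambda>n. A n + B n) sums L"
    by simp
  \<comment> \<open>The inner sum is \<open>theta_coeff q n - q ^ n * hecke_coeff q n\<close>. Its
    product with \<open>(1 + q ^ n) * P n\<close> is \<open>A n + B n - V n\<close>; the remaining
    part is \<open>V (Suc n)\<close>, by \<open>P_Suc\<close> and the recursion of
    \<open>hecke_coeff\<close>.\<close>
  have summand: "(\<Sum>j\<in>{- int n..int n}.
          (-1) powi (int n + j) * q powi ((3 * int n ^ 2 - int n) div 2 - j ^ 2)
          * ((\<Prod>k<n. a - q ^ (k + 1)) / qpoch a q n)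
          * (1 + q ^ n + (1 + q ^ (n + 1)) * (q ^ (2 * n) * (a - q ^ (n + 1)) / (1 - a * q ^ n))))
      = A n + B n + (V (Suc n) - V n)" (is "?X = _") for n
  proof -
    let ?w = "(a - q ^ (n + 1)) / (1 - a * q ^ n)"
    have "?X = (theta_coeff q n - q ^ n * hecke_coeff q n) * P n
        * (1 + q ^ n + (1 + q ^ (n + 1)) * (q ^ (2 * n) * (a - q ^ (n + 1)) / (1 - a * q ^ n)))"
      unfolding sum_distrib_right[symmetric] hecke_coeff_eq_sum'[OF q0] P_def basis_poly_def ..
    also have "\<dots> = (theta_coeff q n - q ^ n * hecke_coeff q n)
        * ((1 + q ^ n) * P n + (1 + q ^ (n + 1)) * q ^ (2 * n) * (P n * ?w))"
      by (simp only: times_divide_eq_right[symmetric]) algebra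
    also have "\<dots> = A n + B n + (V (Suc n) - V n)"
    proof -
      define y where "y = q ^ n"
      have y: "q ^ (2 * n) = y * y" "q ^ (3 * n) = y * (y * y)"
        unfolding y_def by (simp_all only: mult_2 power_add numeral_3_eq_3 mult_Suc mult_0 add_0_right)
      show ?thesis
        unfolding P_Suc A_def B_def V_def hecke_coeff.simps(2)
        unfolding y y_def[symmetric] Suc_eq_plus1
        by algebra
    qed
    finally show ?thesis .
  qed
  have "(\<lambda>n. A n + B n + (V (Suc n) - V n)) sums (L + (0 - V 0))"
    by (intro sums_add AB telescope_sums V)
  \<comment> \<open>\<open>V 0 = 0\<close> because \<open>hecke_coeff q 0 = 0\<close>.\<close>
  then have first: "(\<lambda>n. A n + B n + (V (Suc n) - V n)) sums L"
    by (simp add: V_def)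
  have A_Suc: "A (Suc n) = 2 * ((1 + q ^ (n + 1)) * ((\<Prod>k<n+1. a - q ^ (k + 1)) / qpoch a q (n + 1))
                      * q ^ ((n + 1) * n div 2))" for n
    unfolding A_def P_def basis_poly_def theta_coeff_def by simp
  have B_Suc: "- B (Suc n) = (1 - q ^ (2 * (n + 1)))
                      * ((\<Prod>k<n+1. - (a - q ^ (k + 1))) / qpoch a q (n + 1))
                      * (\<Sum>j\<in>{- int n..int n}. (-1) powi j * q powi (3 * int (n + 1) * int n div 2 - j ^ 2))"
    for n
  proof -
    \<comment> \<open>The \<open>n + 1\<close> negated factors give \<open>(-1)^(n+1)\<close>
      against \<open>(-1)^n\<close> in \<open>hecke_coeff\<close>, hence the minus sign before
      \<open>B\<close>.\<close>
    have "(\<Prod>k<m. - (a - q ^ (k + 1))) = (- 1) ^ m * basis_poly q m a" for m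
      by (induction m) (simp_all add: basis_poly_Suc algebra_simps)
    note prod = this[of "n + 1"]
    show ?thesis
      unfolding B_def P_def prod hecke_coeff_eq_sum[OF q0] by simp
  qed
  have A_tail: "summable (\<lambda>n. A (Suc n))" and B_tail: "summable (\<lambda>n. B (Suc n))"
    using A B by (simp_all only: summable_Suc_iff)
  have second: "summable (\<lambda>n. (1 + q ^ (n + 1)) * ((\<Prod>k<n+1. a - q ^ (k + 1)) / qpoch a q (n + 1))
                      * q ^ ((n + 1) * n div 2))"
    using A_tail unfolding A_Suc by (subst (asm) summable_cmult_iff) simp
  have "L = suminf A + suminf B"
    using AB suminf_add[OF A B] sums_unique by metis
  \<comment> \<open>The constant 2 is \<open>A 0\<close>; \<open>B 0\<close> vanishes.\<close>
  also have "suminf A = 2 + (\<Sum>n. A (Suc n))"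
    unfolding suminf_split_head[OF A] by (simp add: A_def P_def)
  also have "suminf B = - (\<Sum>n. - B (Suc n))"
    unfolding suminf_minus[OF B_tail] suminf_split_head[OF B] by (simp add: B_def)
  finally have L: "L = 2 + (\<Sum>n. A (Suc n)) - (\<Sum>n. - B (Suc n))"
    by simp
  show ?thesis
    using tail first second summable_minus[OF B_tail] L
    unfolding summand A_Suc B_Suc suminf_mult[OF second] by (intro conjI)
qed

end
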